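(* Let $\mathrm{H}:\mathbf{Top}_0\to\mathbf{Set}$ be an R-subset system having property M and $\{X_i:i\in I\}$ a family of $T_0$ spaces. Then the following two conditions are equivalent: (1) The product space $\prod_{i\in I}X_i$ is super $\mathrm{H}$-sober. (2) For each $i\in I$, $X_i$ is super $\mathrm{H}$-sober.
   Context: $\mathbf{Top}_0$ is the category of all $T_0$ spaces with continuous mappings, and $\mathbf{Set}$ is the category of all sets with mappings. A subset $A$ of a space $X$ is irreducible if it is nonempty and whenever $A\subseteq F_1\cup F_2$ with $F_1,F_2$ closed in $X$, then $A\subseteq F_1$ or $A\subseteq F_2$. An R-subset system (irreducible subset system) is a covariant functor $\mathrm{H}:\mathbf{Top}_0\to\mathbf{Set}$ such that (i) for every $T_0$ space $X$, $\mathrm{H}(X)$ is a set of irreducible subsets of $X$ which contains all singletons $\{x\}$, $x\in X$; (ii) for every continuous mapping $f:X\to Y$ between $T_0$ spaces and every $A\in \mathrm{H}(X)$, $\mathrm{H}(f)(A)=f(A)\in \mathrm{H}(Y)$. A $T_0$ space $X$ is $\mathrm{H}$-sober if for every $A\in\mathrm{H}(X)$ there is a (necessarily unique) point $x\in X$ with $\overline{A}=\overline{\{x\}}$. The specialization order of a $T_0$ space $X$ is $x\le y$ iff $x\in\overline{\{y\}}$; $\mathord{\uparrow}A$ is the upper closure of $A$ in this order. A subset is saturated if it is an intersection of open sets (equivalently, an upper set). $\mathsf{K}(X)$ is the set of all nonempty compact saturated subsets of $X$. The Smyth power space $P_S(X)$ is $\mathsf{K}(X)$ with the topology having as base the sets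 $\Box U=\{K\in\mathsf{K}(X):K\subseteq U\}$, $U$ open in $X$ (it is a $T_0$ space). A $T_0$ space $X$ is super $\mathrm{H}$-sober if $P_S(X)$ is $\mathrm{H}$-sober. $\mathrm{H}$ has property M if for every $T_0$ space $X$, every $\mathcal K\in\mathrm{H}(P_S(X))$ and every closed $A\subseteq X$ with $K\cap A\neq\emptyset$ for all $K\in\mathcal K$, one has $\{\mathord{\uparrow}(K\cap A):K\in\mathcal K\}\in\mathrm{H}(P_S(X))$.
   Formalization: All factors X_i are assumed nonempty (with an empty factor the product is empty, hence super H-sober, while another factor need not be); H is given on T_0 spaces over an arbitrary set of points large enough to contain a copy of the Smyth power space of the product. *)

theory Defs
  imports "HOL-Analysis.Analysis"
begin

section \<open>Irreducible sets, specialization order, Smyth power space\<close>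

definition irreducible_in :: "'a topology \<Rightarrow> 'a set \<Rightarrow> bool" where
  "irreducible_in X A \<longleftrightarrow>
     A \<subseteq> topspace X \<and> A \<noteq> {} \<and>
     (\<forall>F1 F2. closedin X F1 \<and> closedin X F2 \<and> A \<subseteq> F1 \<union> F2 \<longrightarrow> A \<subseteq> F1 \<or> A \<subseteq> F2)"

definition spec_le :: "'a topology \<Rightarrow> 'a \<Rightarrow> 'a \<Rightarrow> bool" where
  "spec_le X x y \<longleftrightarrow> x \<in> topspace X \<and> y \<in> topspace X \<and> x \<in> X closure_of {y}"

definition up_closure :: "'a topology \<Rightarrow> 'a set \<Rightarrow> 'a set" where
  "up_closure X A = {y. \<exists>x\<in>A. spec_le X x y}"

text \<open>The intersection of the empty family of open sets is the whole space.\<close>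

definition saturated_in :: "'a topology \<Rightarrow> 'a set \<Rightarrow> bool" where
  "saturated_in X S \<longleftrightarrow>
     (\<exists>\<U>. (\<forall>U\<in>\<U>. openin X U) \<and> S = topspace X \<inter> \<Inter>\<U>)"

definition compact_saturated :: "'a topology \<Rightarrow> 'a set set" where
  "compact_saturated X = {K. K \<noteq> {} \<and> compactin X K \<and> saturated_in X K}"

definition smyth_box :: "'a topology \<Rightarrow> 'a set \<Rightarrow> 'a set set" where
  "smyth_box X U = {K \<in> compact_saturated X. K \<subseteq> U}"

definition smyth_power :: "'a topology \<Rightarrow> 'a set topology" where
  "smyth_power X =
     topology (arbitrary union_of (\<lambda>\<B>. \<exists>U. openin X U \<and> \<B> = smyth_box X U))"

lemma openin_smyth_power:
  "openin (smyth_power X) =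
     arbitrary union_of (\<lambda>\<B>. \<exists>U. openin X U \<and> \<B> = smyth_box X U)"
proof -
  have "\<exists>W. openin X W \<and> smyth_box X U \<inter> smyth_box X V = smyth_box X W"
    if "openin X U" "openin X V" for U V
    using that by (intro exI[of _ "U \<inter> V"]) (auto simp: smyth_box_def)
  then have "istopology (arbitrary union_of (\<lambda>\<B>. \<exists>U. openin X U \<and> \<B> = smyth_box X U))"
    by (intro istopology_base) blast
  then show ?thesis
    by (simp add: smyth_power_def)
qed

lemma openin_smyth_box: "openin X U \<Longrightarrow> openin (smyth_power X) (smyth_box X U)"
  unfolding openin_smyth_power by (rule arbitrary_union_of_inc) blast

lemma topspace_smyth_power [simp]: "topspace (smyth_power X) = compact_saturated X"
proof
  show "topspace (smyth_power X) \<subseteq> compact_saturated X"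
    using openin_topspace[of "smyth_power X"]
    unfolding openin_smyth_power union_of_def smyth_box_def by auto
  have "compact_saturated X = smyth_box X (topspace X)"
    by (auto simp: smyth_box_def compact_saturated_def compactin_def)
  then show "compact_saturated X \<subseteq> topspace (smyth_power X)"
    using openin_smyth_box[of X "topspace X"] openin_subset by auto
qed

lemma t0_space_smyth_power: "t0_space (smyth_power X)"
proof -
  have separate: "\<exists>U. openin X U \<and> K \<subseteq> U \<and> \<not> L \<subseteq> U"
    if "K \<in> compact_saturated X" "L \<in> compact_saturated X" "\<not> L \<subseteq> K" for K L
  proof -
    obtain \<U> where \<U>: "\<forall>U\<in>\<U>. openin X U" "K = topspace X \<inter> \<Inter>\<U>"
      using \<open>K \<in> compact_saturated X\<close> by (auto simp: compact_saturated_def saturated_in_def)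
    have "L \<subseteq> topspace X"
      using that(2) by (auto simp: compact_saturated_def compactin_def)
    with that(3) \<U>(2) obtain U where "U \<in> \<U>" "\<not> L \<subseteq> U" by blast
    with \<U> show ?thesis by blast
  qed
  show ?thesis
    unfolding t0_space_def topspace_smyth_power
  proof (intro ballI impI)
    fix K L assume KL: "K \<in> compact_saturated X" "L \<in> compact_saturated X" "K \<noteq> L"
    then have "\<not> L \<subseteq> K \<or> \<not> K \<subseteq> L" by blast
    then have "\<exists>U. openin X U \<and> (K \<subseteq> U \<longleftrightarrow> \<not> L \<subseteq> U)"
      using separate[OF KL(1) KL(2)] separate[OF KL(2) KL(1)] by metis
    then obtain U where U: "openin X U" "K \<subseteq> U \<longleftrightarrow> \<not> L \<subseteq> U" by blast
    then have "K \<notin> smyth_box X U \<longleftrightarrow> L \<in> smyth_box X U"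
      using KL(1,2) by (simp add: smyth_box_def)
    then show "\<exists>W. openin (smyth_power X) W \<and> (K \<notin> W \<longleftrightarrow> L \<in> W)"
      using openin_smyth_box[OF U(1)] by blast
  qed
qed


section \<open>R-subset systems\<close>

text \<open>
  No HOL type contains all T0 spaces, so a system \<open>H\<close> is given on the T0 spaces whose points
  lie in a type \<open>'u\<close>; \<open>'u\<close> is arbitrary and serves as the universe of points.
  The requirement \<open>H(f)(A) = f(A)\<close> determines the functor on morphisms (and makes
  preservation of identities and composites automatic), so only its object part appears.
\<close>

definition R_subset_system :: "('u topology \<Rightarrow> 'u set set) \<Rightarrow> bool" where
  "R_subset_system H \<longleftrightarrow>
     (\<forall>X. t0_space X \<longrightarrow>
        (\<forall>A\<in>H X. irreducible_in X A) \<and> (\<forall>x\<in>topspace X. {x} \<in> H X)) \<and>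
     (\<forall>X Y f. t0_space X \<and> t0_space Y \<and> continuous_map X Y f \<longrightarrow>
        (\<forall>A\<in>H X. f ` A \<in> H Y))"

text \<open>
  The value of \<open>H\<close> at a space \<open>X\<close> over another type (such as a Smyth power space),
  transported along a homeomorphism onto a space with points in \<open>'u\<close>. It does not depend on the
  homeomorphism, agrees with \<open>H\<close> on spaces over \<open>'u\<close> and satisfies the
  axioms of an R-subset system (lemmas below). It is the intended value only if \<open>X\<close> has
  such a copy, that is, if \<open>topspace X\<close> injects into \<open>'u\<close>; otherwise it is empty.
\<close>

definition H_at :: "('u topology \<Rightarrow> 'u set set) \<Rightarrow> 'b topology \<Rightarrow> 'b set set" where
  "H_at H X =
     {A. A \<subseteq> topspace X \<and> (\<exists>Y f. homeomorphic_map X Y f \<and> f ` A \<in> H Y)}"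

definition H_sober :: "('u topology \<Rightarrow> 'u set set) \<Rightarrow> 'b topology \<Rightarrow> bool" where
  "H_sober H X \<longleftrightarrow>
     t0_space X \<and>
     (\<forall>A\<in>H_at H X. \<exists>x\<in>topspace X. X closure_of A = X closure_of {x})"

definition super_H_sober :: "('u topology \<Rightarrow> 'u set set) \<Rightarrow> 'b topology \<Rightarrow> bool" where
  "super_H_sober H X \<longleftrightarrow> t0_space X \<and> H_sober H (smyth_power X)"

text \<open>
  Since a T0 space embeds in its Smyth power space, every space whose Smyth power space has a
  copy over \<open>'u\<close> has one itself, so it suffices to let \<open>X\<close> range over spaces over \<open>'u\<close>.
\<close>

definition property_M :: "('u topology \<Rightarrow> 'u set set) \<Rightarrow> bool" where
  "property_M H \<longleftrightarrow>
     (\<forall>X :: 'u topology. t0_space X \<longrightarrow>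
        (\<forall>\<K>\<in>H_at H (smyth_power X). \<forall>A.
           closedin X A \<and> (\<forall>K\<in>\<K>. K \<inter> A \<noteq> {}) \<longrightarrow>
           (\<lambda>K. up_closure X (K \<inter> A)) ` \<K> \<in> H_at H (smyth_power X)))"

lemma homeomorphic_map_t0_space:
  "homeomorphic_map X Y f \<Longrightarrow> t0_space X \<longleftrightarrow> t0_space Y"
  by (meson homeomorphic_map_imp_homeomorphic_space homeomorphic_t0_space)

lemma exists_copy:
  fixes X :: "'b topology" and e :: "'b \<Rightarrow> 'u"
  assumes "inj_on e (topspace X)"
  shows "\<exists>Y. homeomorphic_map X Y e"
proof -
  define g where "g = inv_into (topspace X) e"
  define Y where "Y = pullback_topology (e ` topspace X) g X"
  have ge: "g (e x) = x" if "x \<in> topspace X" for x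
    using that assms by (simp add: g_def)
  have top: "topspace Y = e ` topspace X"
    unfolding Y_def topspace_pullback_topology using ge by auto
  have "continuous_map Y X (id \<circ> g)"
    unfolding Y_def by (rule continuous_map_pullback) simp
  then have g: "continuous_map Y X g" by simp
  have "continuous_map X X (g \<circ> e)"
    by (intro continuous_map_eq[OF continuous_map_id]) (simp add: ge)
  then have e: "continuous_map X Y e"
    unfolding Y_def by (intro continuous_map_pullback') auto
  have "homeomorphic_maps X Y e g"
    unfolding homeomorphic_maps_def top
    using e g ge by simp
  then show ?thesis
    unfolding homeomorphic_map_maps by blast
qed

lemma H_at_transport:
  assumes H: "R_subset_system H" and X: "t0_space X"
    and f: "homeomorphic_map X Y f" and A: "A \<subseteq> topspace X"
  shows "A \<in> H_at H X \<longleftrightarrow> f ` A \<in> H Y"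
proof
  assume "A \<in> H_at H X"
  then obtain Z h where h: "homeomorphic_map X Z h" "h ` A \<in> H Z"
    by (auto simp: H_at_def)
  obtain k where k: "homeomorphic_maps X Z h k"
    using h(1) homeomorphic_map_maps by blast
  have "continuous_map Z Y (f \<circ> k)"
    using k f by (meson continuous_map_compose homeomorphic_imp_continuous_map homeomorphic_maps_def)
  then have "(f \<circ> k) ` (h ` A) \<in> H Y"
    using H X h f unfolding R_subset_system_def by (metis homeomorphic_map_t0_space)
  moreover have "(f \<circ> k) ` (h ` A) = f ` A"
    using k A by (force simp: homeomorphic_maps_def image_iff subset_iff)
  ultimately show "f ` A \<in> H Y" by simp
next
  assume "f ` A \<in> H Y"
  then show "A \<in> H_at H X" using f A by (auto simp: H_at_def)
qed

lemma H_at_eq: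
  fixes H :: "'u topology \<Rightarrow> 'u set set"
  assumes H: "R_subset_system H" and X: "t0_space X"
  shows "H_at H X = H X"
proof -
  have "A \<subseteq> topspace X" if "A \<in> H X" for A
    using H X that by (auto simp: R_subset_system_def irreducible_in_def)
  moreover have "A \<in> H_at H X \<longleftrightarrow> A \<in> H X" if "A \<subseteq> topspace X" for A
    using H_at_transport[OF H X homeomorphic_map_id[THEN iffD2, OF refl] that] by simp
  moreover have "A \<subseteq> topspace X" if "A \<in> H_at H X" for A
    using that by (simp add: H_at_def)
  ultimately show ?thesis by blast
qed

lemma H_at_irreducible:
  assumes H: "R_subset_system H" and X: "t0_space X" and A: "A \<in> H_at H X"
  shows "irreducible_in X A"
proof -
  obtain Y f where f: "homeomorphic_map X Y f" "f ` A \<in> H Y" and AX: "A \<subseteq> topspace X"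
    using A by (auto simp: H_at_def)
  have irr: "irreducible_in Y (f ` A)"
    using H X f unfolding R_subset_system_def by (metis homeomorphic_map_t0_space)
  have inj: "inj_on f (topspace X)"
    using f(1) by (simp add: homeomorphic_eq_everything_map)
  have "A \<subseteq> F1 \<or> A \<subseteq> F2"
    if F: "closedin X F1" "closedin X F2" "A \<subseteq> F1 \<union> F2" for F1 F2
  proof -
    have "closedin Y (f ` F1)" "closedin Y (f ` F2)"
      using F f(1) by (meson closed_map_def homeomorphic_imp_closed_map)+
    moreover have "f ` A \<subseteq> f ` F1 \<union> f ` F2" using F(3) by blast
    ultimately have "f ` A \<subseteq> f ` F1 \<or> f ` A \<subseteq> f ` F2"
      using irr unfolding irreducible_in_def by blast
    then show ?thesis
      using inj_on_image_subset_iff[OF inj AX] F(1,2) closedin_subset by blast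
  qed
  then show ?thesis
    using AX irr by (auto simp: irreducible_in_def)
qed

lemma H_at_singleton:
  fixes H :: "'u topology \<Rightarrow> 'u set set" and e :: "'b \<Rightarrow> 'u"
  assumes H: "R_subset_system H" and X: "t0_space X"
    and e: "inj_on e (topspace X)" and x: "x \<in> topspace X"
  shows "{x} \<in> H_at H X"
proof -
  obtain Y where Y: "homeomorphic_map X Y e" using exists_copy[OF e] by blast
  have "{e x} \<in> H Y"
    using H X x Y unfolding R_subset_system_def
    by (metis homeomorphic_map_t0_space homeomorphic_imp_surjective_map imageI)
  then show ?thesis using x Y by (auto simp: H_at_def)
qed

lemma H_at_image:
  fixes H :: "'u topology \<Rightarrow> 'u set set" and e :: "'c \<Rightarrow> 'u"
  assumes H: "R_subset_system H" and X: "t0_space X" and Y: "t0_space Y"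
    and e: "inj_on e (topspace Y)"
    and f: "continuous_map X Y f" and A: "A \<in> H_at H X"
  shows "f ` A \<in> H_at H Y"
proof -
  obtain Z h where h: "homeomorphic_map X Z h" "h ` A \<in> H Z" and AX: "A \<subseteq> topspace X"
    using A by (auto simp: H_at_def)
  obtain k where k: "homeomorphic_maps X Z h k"
    using h(1) homeomorphic_map_maps by blast
  obtain W where W: "homeomorphic_map Y W e" using exists_copy[OF e] by blast
  have "continuous_map Z W (e \<circ> (f \<circ> k))"
    using k f W
    by (meson continuous_map_compose homeomorphic_imp_continuous_map homeomorphic_maps_def)
  then have "(e \<circ> (f \<circ> k)) ` (h ` A) \<in> H W"
    using H X Y h W unfolding R_subset_system_def by (metis homeomorphic_map_t0_space)
  moreover have "(e \<circ> (f \<circ> k)) ` (h ` A) = e ` (f ` A)"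
    using k AX by (force simp: homeomorphic_maps_def image_iff subset_iff)
  moreover have "f ` A \<subseteq> topspace Y"
    using f AX by (auto simp: continuous_map_def)
  ultimately show ?thesis
    using W by (auto simp: H_at_def)
qed

end

theory Submission
  imports Defs
begin

text \<open>
  Both directions use that the Smyth power space is functorial: a continuous map \<open>f\<close> sends a
  compact saturated set \<open>K\<close> to the saturation of \<open>f ` K\<close>.

  From the product to a factor: since all factors are nonempty, every factor is a retract of the
  product, hence its Smyth power space is a retract of the Smyth power space of the product, and
  \<open>H\<close>-sobriety passes to retracts (\<open>H_sober_retract\<close>).

  From the factors to the product \<open>P\<close>: a family \<open>\<K>\<close> in \<open>H (P\<^sub>S P)\<close> has a generic point as soon as
  every open \<open>U \<supseteq> \<Inter>\<K>\<close> includes a member of \<open>\<K>\<close>, and the generic point is then \<open>\<Inter>\<K>\<close>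
  (\<open>smyth_generic_point\<close>). Suppose that an open
  \<open>U \<supseteq> \<Inter>\<K>\<close> includes no member of \<open>\<K>\<close>. By compactness and
  Zorn's lemma, some minimal closed set \<open>A\<close> disjoint from \<open>U\<close> meets every member of \<open>\<K>\<close>, and \<open>A\<close> is
  irreducible because \<open>\<K>\<close> is (\<open>topological_Rudin\<close>). Property M and functoriality put the saturated
  projections of the sets \<open>K \<inter> A\<close> into \<open>H (P\<^sub>S (X i))\<close>; the generic point of this family is a
  compact saturated set that must meet the closure of the projection of \<open>A\<close>, say in \<open>x i\<close>
  (\<open>generic_coordinate\<close>). Now every \<open>K \<inter> A\<close> has a point whose \<open>i\<close>-th coordinate lies below \<open>x i\<close>, so
  minimality forces the \<open>i\<close>-th coordinates of all points of \<open>A\<close> to lie below \<open>x i\<close>. Thus \<open>x\<close> is an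
  upper bound of \<open>A\<close>, so \<open>x\<close> belongs to every saturated set that meets \<open>A\<close>, in particular to \<open>\<Inter>\<K>\<close>.
  On the other hand, \<open>x\<close> lies in the irreducible closed set \<open>A\<close>, since each coordinate \<open>x i\<close> is in
  the closure of the projection (\<open>irreducible_in_product_closure\<close>). Hence \<open>x \<in> \<Inter>\<K> - U\<close>,
  a contradiction.
\<close>

section \<open>Specialization order and saturation\<close>

lemma spec_le_iff:
  "spec_le X x y \<longleftrightarrow>
     x \<in> topspace X \<and> y \<in> topspace X \<and> (\<forall>U. openin X U \<and> x \<in> U \<longrightarrow> y \<in> U)"
  by (auto simp: spec_le_def in_closure_of)

lemma spec_le_trans: "spec_le X x y \<Longrightarrow> spec_le X y z \<Longrightarrow> spec_le X x z"
  by (auto simp: spec_le_iff)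

lemma spec_le_continuous_map:
  assumes "continuous_map X Y f" "spec_le X x y"
  shows "spec_le Y (f x) (f y)"
proof -
  have "f x \<in> topspace Y" "f y \<in> topspace Y"
    using assms by (auto simp: spec_le_def continuous_map_def)
  moreover have "f y \<in> U" if "openin Y U" "f x \<in> U" for U
    using assms that openin_continuous_map_preimage[OF assms(1) that(1)]
    by (auto simp: spec_le_iff)
  ultimately show ?thesis
    by (auto simp: spec_le_iff)
qed

lemma spec_le_product_topology:
  assumes "x \<in> topspace (product_topology X I)" "y \<in> topspace (product_topology X I)"
    and "\<And>i. i \<in> I \<Longrightarrow> spec_le (X i) (y i) (x i)"
  shows "spec_le (product_topology X I) y x"
proof -
  have "{x} = PiE I (\<lambda>i. {x i})"
    using assms(1) by (auto simp: PiE_iff fun_eq_iff extensional_def) metis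
  then have "(product_topology X I) closure_of {x} = PiE I (\<lambda>i. X i closure_of {x i})"
    by (simp add: closure_of_product_topology)
  then show ?thesis
    using assms by (auto simp: spec_le_def PiE_iff)
qed

lemma saturated_in_upper:
  "saturated_in X S \<Longrightarrow> x \<in> S \<Longrightarrow> spec_le X x y \<Longrightarrow> y \<in> S"
  by (auto simp: saturated_in_def spec_le_iff)

lemma upper_imp_saturated_in:
  assumes "S \<subseteq> topspace X" "\<And>x y. x \<in> S \<Longrightarrow> spec_le X x y \<Longrightarrow> y \<in> S"
  shows "saturated_in X S"
  unfolding saturated_in_def
proof (intro exI conjI ballI)
  let ?\<U> = "(\<lambda>z. topspace X - X closure_of {z}) ` (topspace X - S)"
  show "openin X U" if "U \<in> ?\<U>" for U
    using that by auto
  show "S = topspace X \<inter> \<Inter>?\<U>"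
  proof
    show "S \<subseteq> topspace X \<inter> \<Inter>?\<U>"
      using assms by (fastforce simp: spec_le_def)
    show "topspace X \<inter> \<Inter>?\<U> \<subseteq> S"
      using closure_of_subset[of "{_}" X] by fastforce
  qed
qed

lemma up_closure_subset_topspace: "up_closure X A \<subseteq> topspace X"
  by (auto simp: up_closure_def spec_le_def)

lemma subset_up_closure: "A \<subseteq> topspace X \<Longrightarrow> A \<subseteq> up_closure X A"
  by (force simp: up_closure_def spec_le_iff)

lemma saturated_in_up_closure: "saturated_in X (up_closure X A)"
proof (rule upper_imp_saturated_in[OF up_closure_subset_topspace])
  fix x y assume "x \<in> up_closure X A" "spec_le X x y"
  then show "y \<in> up_closure X A"
    using spec_le_trans[of X _ x y] unfolding up_closure_def by blast
qed

lemma up_closure_subset_open_iff: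
  assumes "A \<subseteq> topspace X" "openin X U"
  shows "up_closure X A \<subseteq> U \<longleftrightarrow> A \<subseteq> U"
  using subset_up_closure[OF assms(1)] assms(2) by (auto simp: up_closure_def spec_le_iff)

lemma up_closure_saturated:
  assumes "saturated_in X S"
  shows "up_closure X S = S"
proof
  show "up_closure X S \<subseteq> S"
    using saturated_in_upper[OF assms] unfolding up_closure_def by blast
  show "S \<subseteq> up_closure X S"
    using assms by (intro subset_up_closure) (auto simp: saturated_in_def)
qed

text \<open>Open sets cannot tell a set from its saturation, so saturating preserves compactness.\<close>

lemma compactin_up_closure:
  assumes "compactin X A"
  shows "compactin X (up_closure X A)"
  unfolding compactin_def
proof (intro conjI allI impI)
  have A: "A \<subseteq> topspace X"
    using assms by (rule compactin_subset_topspace)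
  show "up_closure X A \<subseteq> topspace X"
    by (rule up_closure_subset_topspace)
  fix \<U> assume \<U>: "(\<forall>U\<in>\<U>. openin X U) \<and> up_closure X A \<subseteq> \<Union>\<U>"
  then have "A \<subseteq> \<Union>\<U>"
    using subset_up_closure[OF A] by blast
  then obtain \<F> where \<F>: "finite \<F>" "\<F> \<subseteq> \<U>" "A \<subseteq> \<Union>\<F>"
    using compactinD[OF assms, of \<U>] \<U> by blast
  have "openin X (\<Union>\<F>)"
    using \<U> \<F>(2) by (intro openin_Union) auto
  then have "up_closure X A \<subseteq> \<Union>\<F>"
    using up_closure_subset_open_iff[OF A] \<F>(3) by simp
  then show "\<exists>\<F>. finite \<F> \<and> \<F> \<subseteq> \<U> \<and> up_closure X A \<subseteq> \<Union>\<F>"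
    using \<F>(1,2) by (intro exI[of _ \<F>] conjI)
qed

lemma up_closure_in_compact_saturated:
  assumes "compactin X A" "A \<noteq> {}"
  shows "up_closure X A \<in> compact_saturated X"
proof -
  have "up_closure X A \<noteq> {}"
    using subset_up_closure[OF compactin_subset_topspace[OF assms(1)]] assms(2) by blast
  then show ?thesis
    using assms(1) by (simp add: compact_saturated_def compactin_up_closure saturated_in_up_closure)
qed

lemma compact_saturated_subset_topspace: "K \<in> compact_saturated X \<Longrightarrow> K \<subseteq> topspace X"
  by (auto simp: compact_saturated_def compactin_subset_topspace)


section \<open>The Smyth power space as a functor\<close>

lemma openin_smyth_power_iff:
  "openin (smyth_power X) W \<longleftrightarrow>
     W \<subseteq> compact_saturated X \<and>
     (\<forall>K\<in>W. \<exists>U. openin X U \<and> K \<subseteq> U \<and> smyth_box X U \<subseteq> W)"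
proof
  assume W: "openin (smyth_power X) W"
  then have "W \<subseteq> compact_saturated X"
    using openin_subset[of "smyth_power X" W] by simp
  moreover have "\<exists>U. openin X U \<and> K \<subseteq> U \<and> smyth_box X U \<subseteq> W" if K: "K \<in> W" for K
  proof -
    obtain U where "openin X U" "K \<in> smyth_box X U" "smyth_box X U \<subseteq> W"
      using W K unfolding openin_smyth_power arbitrary_union_of_alt by blast
    then show ?thesis
      by (auto simp: smyth_box_def)
  qed
  ultimately show "W \<subseteq> compact_saturated X \<and>
     (\<forall>K\<in>W. \<exists>U. openin X U \<and> K \<subseteq> U \<and> smyth_box X U \<subseteq> W)" by blast
next
  assume W: "W \<subseteq> compact_saturated X \<and>
     (\<forall>K\<in>W. \<exists>U. openin X U \<and> K \<subseteq> U \<and> smyth_box X U \<subseteq> W)"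
  have "\<exists>T. openin (smyth_power X) T \<and> K \<in> T \<and> T \<subseteq> W" if K: "K \<in> W" for K
  proof -
    obtain U where "openin X U" "K \<subseteq> U" "smyth_box X U \<subseteq> W"
      using W K by blast
    then show ?thesis
      using openin_smyth_box W K by (intro exI[of _ "smyth_box X U"]) (auto simp: smyth_box_def)
  qed
  then show "openin (smyth_power X) W"
    using openin_subopen by blast
qed

lemma in_smyth_closure_of:
  assumes "\<K> \<subseteq> compact_saturated X"
  shows "Q \<in> smyth_power X closure_of \<K> \<longleftrightarrow>
     Q \<in> compact_saturated X \<and> (\<forall>U. openin X U \<and> Q \<subseteq> U \<longrightarrow> (\<exists>K\<in>\<K>. K \<subseteq> U))"
proof
  assume Q: "Q \<in> smyth_power X closure_of \<K>"
  then have QX: "Q \<in> compact_saturated X"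
    by (auto simp: in_closure_of)
  moreover have "\<exists>K\<in>\<K>. K \<subseteq> U" if U: "openin X U" "Q \<subseteq> U" for U
  proof -
    have "Q \<in> smyth_box X U"
      using QX U by (simp add: smyth_box_def)
    then obtain K where "K \<in> \<K>" "K \<in> smyth_box X U"
      using Q openin_smyth_box[OF U(1)] unfolding in_closure_of by blast
    then show ?thesis
      by (auto simp: smyth_box_def)
  qed
  ultimately show "Q \<in> compact_saturated X \<and>
      (\<forall>U. openin X U \<and> Q \<subseteq> U \<longrightarrow> (\<exists>K\<in>\<K>. K \<subseteq> U))" by blast
next
  assume R: "Q \<in> compact_saturated X \<and>
      (\<forall>U. openin X U \<and> Q \<subseteq> U \<longrightarrow> (\<exists>K\<in>\<K>. K \<subseteq> U))"
  have "\<exists>K. K \<in> \<K> \<and> K \<in> W" if W: "Q \<in> W" "openin (smyth_power X) W" for W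
  proof -
    obtain U where U: "openin X U" "Q \<subseteq> U" "smyth_box X U \<subseteq> W"
      using W unfolding openin_smyth_power_iff by blast
    then obtain K where "K \<in> \<K>" "K \<subseteq> U"
      using R by blast
    then show ?thesis
      using U assms by (auto simp: smyth_box_def)
  qed
  then show "Q \<in> smyth_power X closure_of \<K>"
    using R by (simp add: in_closure_of)
qed

lemma smyth_closure_of_singleton:
  assumes "Q \<in> compact_saturated X"
  shows "smyth_power X closure_of {Q} = {K \<in> compact_saturated X. Q \<subseteq> K}"
proof -
  have "Q \<subseteq> K"
    if K: "K \<in> compact_saturated X" and le: "\<And>U. openin X U \<Longrightarrow> K \<subseteq> U \<Longrightarrow> Q \<subseteq> U" for K
  proof -
    obtain \<U> where "\<forall>U\<in>\<U>. openin X U" "K = topspace X \<inter> \<Inter>\<U>"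
      using K by (auto simp: compact_saturated_def saturated_in_def)
    then show ?thesis
      using le compact_saturated_subset_topspace[OF assms] by blast
  qed
  then have "K \<in> compact_saturated X \<and> (\<forall>U. openin X U \<and> K \<subseteq> U \<longrightarrow> Q \<subseteq> U) \<longleftrightarrow>
      K \<in> compact_saturated X \<and> Q \<subseteq> K" for K
    by (meson subset_trans)
  then show ?thesis
    using in_smyth_closure_of[of "{Q}" X] assms by (simp add: set_eq_iff)
qed

definition smyth_map :: "'b topology \<Rightarrow> ('a \<Rightarrow> 'b) \<Rightarrow> 'a set \<Rightarrow> 'b set" where
  "smyth_map Y f K = up_closure Y (f ` K)"

lemma continuous_map_smyth_map:
  assumes f: "continuous_map X Y f"
  shows "continuous_map (smyth_power X) (smyth_power Y) (smyth_map Y f)"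
proof -
  have mem: "smyth_map Y f K \<in> compact_saturated Y" if "K \<in> compact_saturated X" for K
    using that image_compactin[OF _ f] unfolding smyth_map_def
    by (intro up_closure_in_compact_saturated) (auto simp: compact_saturated_def)
  have "openin (smyth_power X) {K \<in> compact_saturated X. smyth_map Y f K \<in> W}"
    if W: "openin (smyth_power Y) W" for W
    unfolding openin_smyth_power_iff
  proof (intro conjI ballI)
    fix K assume "K \<in> {K \<in> compact_saturated X. smyth_map Y f K \<in> W}"
    then have K: "K \<in> compact_saturated X" "smyth_map Y f K \<in> W" by auto
    obtain V where V: "openin Y V" "smyth_map Y f K \<subseteq> V" "smyth_box Y V \<subseteq> W"
      using W K(2) unfolding openin_smyth_power_iff by blast
    have sub: "smyth_map Y f L \<subseteq> V \<longleftrightarrow> f ` L \<subseteq> V" if "L \<in> compact_saturated X" for L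
    proof -
      have "f ` L \<subseteq> topspace Y"
        using f compact_saturated_subset_topspace[OF that] by (auto simp: continuous_map_def)
      then show ?thesis
        using up_closure_subset_open_iff V(1) by (simp add: smyth_map_def)
    qed
    let ?U = "{x \<in> topspace X. f x \<in> V}"
    have "openin X ?U"
      using f V(1) by (rule openin_continuous_map_preimage)
    moreover have "K \<subseteq> ?U"
      using sub K V(2) compact_saturated_subset_topspace by blast
    moreover have "smyth_map Y f L \<in> W" if L: "L \<in> compact_saturated X" "L \<subseteq> ?U" for L
    proof -
      have "smyth_map Y f L \<in> smyth_box Y V"
        using sub mem L by (auto simp: smyth_box_def)
      then show ?thesis
        using V(3) by blast
    qed
    ultimately show "\<exists>U. openin X U \<and> K \<subseteq> U \<and>
        smyth_box X U \<subseteq> {K \<in> compact_saturated X. smyth_map Y f K \<in> W}"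
      by (intro exI[of _ ?U]) (auto simp: smyth_box_def)
  qed auto
  then show ?thesis
    using mem by (auto simp: continuous_map_def)
qed

lemma smyth_map_up_closure:
  assumes "continuous_map X Y f" "A \<subseteq> topspace X"
  shows "smyth_map Y f (up_closure X A) = up_closure Y (f ` A)"
proof
  show "smyth_map Y f (up_closure X A) \<subseteq> up_closure Y (f ` A)"
    using spec_le_continuous_map[OF assms(1)] spec_le_trans
    by (fastforce simp: smyth_map_def up_closure_def)
  show "up_closure Y (f ` A) \<subseteq> smyth_map Y f (up_closure X A)"
    using subset_up_closure[OF assms(2)] unfolding smyth_map_def up_closure_def[of Y] by blast
qed

lemma retraction_maps_smyth_map:
  assumes "retraction_maps X Y r s"
  shows "retraction_maps (smyth_power X) (smyth_power Y) (smyth_map Y r) (smyth_map X s)"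
proof -
  have rs: "continuous_map X Y r" "continuous_map Y X s" "\<And>y. y \<in> topspace Y \<Longrightarrow> r (s y) = y"
    using assms unfolding retraction_maps_def by blast+
  have "smyth_map Y r (smyth_map X s K) = K" if K: "K \<in> compact_saturated Y" for K
  proof -
    have KY: "K \<subseteq> topspace Y"
      using K by (rule compact_saturated_subset_topspace)
    then have "s ` K \<subseteq> topspace X"
      using rs(2) by (auto simp: continuous_map_def)
    then have "smyth_map Y r (smyth_map X s K) = up_closure Y (r ` s ` K)"
      using smyth_map_up_closure[OF rs(1)] by (simp add: smyth_map_def[of X])
    also have "r ` s ` K = K"
      using KY rs(3) by (force simp: image_iff)
    also have "up_closure Y K = K"
      using K by (auto simp: compact_saturated_def up_closure_saturated)
    finally show ?thesis .
  qed
  then show ?thesis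
    using rs by (simp add: retraction_maps_def continuous_map_smyth_map)
qed

lemma retraction_maps_inj_on: "retraction_maps X Y r s \<Longrightarrow> inj_on s (topspace Y)"
  by (rule inj_on_inverseI[of _ r]) (simp add: retraction_maps_def)

lemma inj_on_smyth_power_retract:
  assumes "retraction_maps X Y r s" "inj_on e (topspace (smyth_power X))"
  shows "inj_on (e \<circ> smyth_map X s) (topspace (smyth_power Y))"
proof (rule comp_inj_on)
  have r: "retraction_maps (smyth_power X) (smyth_power Y) (smyth_map Y r) (smyth_map X s)"
    using assms(1) by (rule retraction_maps_smyth_map)
  then show "inj_on (smyth_map X s) (topspace (smyth_power Y))"
    by (rule retraction_maps_inj_on)
  have "smyth_map X s ` topspace (smyth_power Y) \<subseteq> topspace (smyth_power X)"
    by (rule continuous_map_image_subset_topspace) (use r in \<open>simp add: retraction_maps_def\<close>)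
  then show "inj_on e (smyth_map X s ` topspace (smyth_power Y))"
    using assms(2) by (rule inj_on_subset[rotated])
qed


section \<open>Retracts and copies\<close>

lemma H_sober_retract:
  fixes H :: "'u topology \<Rightarrow> 'u set set" and e :: "'b \<Rightarrow> 'u"
  assumes H: "R_subset_system H" and Y: "H_sober H Y" and X: "t0_space X"
    and e: "inj_on e (topspace Y)" and rs: "retraction_maps Y X r s"
  shows "H_sober H X"
  unfolding H_sober_def
proof (intro conjI ballI X)
  have r: "continuous_map Y X r" and s: "continuous_map X Y s"
    and id: "\<And>x. x \<in> topspace X \<Longrightarrow> r (s x) = x"
    using rs by (simp_all add: retraction_maps_def)
  have Y0: "t0_space Y"
    using Y by (simp add: H_sober_def)
  fix A assume A: "A \<in> H_at H X"
  then have AX: "A \<subseteq> topspace X"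
    by (simp add: H_at_def)
  have "s ` A \<in> H_at H Y"
    using H X Y0 e s A by (rule H_at_image)
  then obtain y where y: "y \<in> topspace Y" "Y closure_of (s ` A) = Y closure_of {y}"
    using Y unfolding H_sober_def by blast
  have rsA: "r ` s ` A = A"
    using AX id by (force simp: image_iff)
  have "r y \<in> X closure_of A"
    using continuous_map_image_closure_subset[OF r, of "s ` A"] y closure_of_subset[of "{y}" Y] rsA
    by auto
  moreover have "A \<subseteq> X closure_of {r y}"
  proof -
    have "s ` A \<subseteq> topspace Y"
      using s AX by (auto simp: continuous_map_def)
    then have "s ` A \<subseteq> Y closure_of {y}"
      using y closure_of_subset by metis
    then have "r ` s ` A \<subseteq> X closure_of {r y}"
      using continuous_map_image_closure_subset[OF r, of "{y}"] by auto
    then show ?thesis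
      using rsA by simp
  qed
  ultimately have "X closure_of A = X closure_of {r y}"
    by (intro equalityI closure_of_minimal) auto
  moreover have "r y \<in> topspace X"
    using r y(1) by (auto simp: continuous_map_def)
  ultimately show "\<exists>x\<in>topspace X. X closure_of A = X closure_of {x}" by blast
qed

text \<open>
  Principal filters embed a T0 space into its Smyth power space, so a universe that has room for
  the latter also has room for the space.
\<close>

lemma inj_on_up_closure_singleton:
  assumes "t0_space X"
  shows "inj_on (\<lambda>x. up_closure X {x}) (topspace X)"
proof (rule inj_onI)
  fix x y assume xy: "x \<in> topspace X" "y \<in> topspace X" "up_closure X {x} = up_closure X {y}"
  then have "y \<in> up_closure X {x}" "x \<in> up_closure X {y}"
    using subset_up_closure[of "{x}" X] subset_up_closure[of "{y}" X] by auto
  then have "\<forall>U. openin X U \<longrightarrow> (x \<in> U \<longleftrightarrow> y \<in> U)"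
    by (auto simp: up_closure_def spec_le_iff)
  then show "x = y"
    using assms xy(1,2) unfolding t0_space_def by metis
qed

text \<open>
  Property M speaks of spaces over the universe \<open>'u\<close>; it carries over along a homeomorphism to
  every space whose Smyth power space has a copy over \<open>'u\<close>.
\<close>

lemma property_M_at:
  fixes H :: "'u topology \<Rightarrow> 'u set set" and e :: "'b set \<Rightarrow> 'u"
  assumes H: "R_subset_system H" and M: "property_M H" and X: "t0_space X"
    and e: "inj_on e (topspace (smyth_power X))"
    and \<K>: "\<K> \<in> H_at H (smyth_power X)" and A: "closedin X A"
    and meet: "\<And>K. K \<in> \<K> \<Longrightarrow> K \<inter> A \<noteq> {}"
  shows "(\<lambda>K. up_closure X (K \<inter> A)) ` \<K> \<in> H_at H (smyth_power X)"
proof -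
  have "(\<lambda>x. up_closure X {x}) ` topspace X \<subseteq> topspace (smyth_power X)"
    by (auto intro!: up_closure_in_compact_saturated)
  then have "inj_on (e \<circ> (\<lambda>x. up_closure X {x})) (topspace X)"
    using inj_on_up_closure_singleton[OF X] e by (intro comp_inj_on) (auto intro: inj_on_subset)
  then obtain Z where "homeomorphic_map X Z (e \<circ> (\<lambda>x. up_closure X {x}))"
    using exists_copy by blast
  then obtain h k where hom: "homeomorphic_map X Z h" and hk: "homeomorphic_maps X Z h k"
    unfolding homeomorphic_map_maps by blast
  have h: "continuous_map X Z h" and k: "continuous_map Z X k"
    and kh: "\<And>x. x \<in> topspace X \<Longrightarrow> k (h x) = x"
    and hk': "\<And>z. z \<in> topspace Z \<Longrightarrow> h (k z) = z"
    using hk by (auto simp: homeomorphic_maps_def)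
  have Z: "t0_space Z"
    using X hom homeomorphic_map_t0_space by blast
  have eZ: "inj_on (e \<circ> smyth_map X k) (topspace (smyth_power Z))"
    using inj_on_smyth_power_retract[of X Z h k] e h k hk' by (simp add: retraction_maps_def)
  have \<K>X: "K \<subseteq> topspace X" "saturated_in X K" if "K \<in> \<K>" for K
    using \<K> that compact_saturated_subset_topspace[of K X]
    by (auto simp: H_at_def compact_saturated_def)
  have AX: "A \<subseteq> topspace X"
    using A by (rule closedin_subset)
  let ?\<L> = "smyth_map Z h ` \<K>"
  have L: "?\<L> \<in> H_at H (smyth_power Z)"
    using H t0_space_smyth_power t0_space_smyth_power eZ continuous_map_smyth_map[OF h] \<K>
    by (rule H_at_image)
  have hA: "closedin Z (h ` A)"
    using A hom homeomorphic_imp_closed_map by (auto simp: closed_map_def)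
  \<comment> \<open>A homeomorphism is an order isomorphism, so \<open>h ` K\<close> is already saturated.\<close>
  have Lcut: "smyth_map Z h K \<inter> h ` A = h ` (K \<inter> A)" if K: "K \<in> \<K>" for K
  proof -
    have "smyth_map Z h K \<subseteq> h ` K"
    proof
      fix z assume "z \<in> smyth_map Z h K"
      then obtain x where x: "x \<in> K" "spec_le Z (h x) z"
        by (auto simp: smyth_map_def up_closure_def)
      then have "spec_le X (k (h x)) (k z)"
        using spec_le_continuous_map[OF k] by blast
      then have "spec_le X x (k z)"
        using kh x(1) \<K>X(1)[OF K] by (metis subsetD)
      then have "k z \<in> K"
        using saturated_in_upper[OF \<K>X(2)[OF K] x(1)] by blast
      moreover have "h (k z) = z"
        using x(2) hk' by (simp add: spec_le_def)
      ultimately show "z \<in> h ` K"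
        by (metis imageI)
    qed
    moreover have "h ` K \<subseteq> smyth_map Z h K"
      unfolding smyth_map_def using h \<K>X(1)[OF K]
      by (intro subset_up_closure) (auto simp: continuous_map_def)
    moreover have "h ` K \<inter> h ` A = h ` (K \<inter> A)"
      using kh \<K>X(1)[OF K] AX by (intro inj_on_image_Int[symmetric]) (auto intro: inj_on_inverseI)
    ultimately show ?thesis by blast
  qed
  have "\<forall>L\<in>?\<L>. L \<inter> h ` A \<noteq> {}"
    using meet Lcut by simp
  then have "(\<lambda>L. up_closure Z (L \<inter> h ` A)) ` ?\<L> \<in> H_at H (smyth_power Z)"
    using M[unfolded property_M_def, rule_format, OF Z L] hA by simp
  then have "smyth_map X k ` (\<lambda>L. up_closure Z (L \<inter> h ` A)) ` ?\<L> \<in> H_at H (smyth_power X)"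
    by (rule H_at_image[OF H t0_space_smyth_power t0_space_smyth_power e continuous_map_smyth_map[OF k]])
  moreover have "smyth_map X k (up_closure Z (smyth_map Z h K \<inter> h ` A)) = up_closure X (K \<inter> A)"
    if K: "K \<in> \<K>" for K
  proof -
    have "h ` (K \<inter> A) \<subseteq> topspace Z"
      using h AX by (auto simp: continuous_map_def)
    then have "smyth_map X k (up_closure Z (h ` (K \<inter> A))) = up_closure X (k ` h ` (K \<inter> A))"
      by (rule smyth_map_up_closure[OF k])
    also have "k ` h ` (K \<inter> A) = K \<inter> A"
      using kh AX by (force simp: image_iff)
    finally show ?thesis
      using Lcut[OF K] by simp
  qed
  ultimately show ?thesis
    by (simp add: image_image cong: image_cong_simp)
qed


section \<open>Irreducible families of compact saturated sets\<close>

text \<open>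
  A minimal closed set is obtained as the complement of a maximal open set that includes no
  member of \<open>\<K>\<close>; compactness of the members makes such open sets closed under unions of chains.
  If \<open>A \<subseteq> F\<^sub>1 \<union> F\<^sub>2\<close> and neither \<open>A \<inter> F\<^sub>1\<close> nor \<open>A \<inter> F\<^sub>2\<close> is all of \<open>A\<close>, then by minimality some member of
  \<open>\<K>\<close> misses \<open>A \<inter> F\<^sub>1\<close> and some member misses \<open>A \<inter> F\<^sub>2\<close>; irreducibility of \<open>\<K>\<close>, which replaces the
  directedness in Rudin's original lemma, yields one member that misses both, hence misses \<open>A\<close>.
\<close>

lemma topological_Rudin:
  assumes irr: "irreducible_in (smyth_power X) \<K>" and C: "closedin X C"
    and meet: "\<And>K. K \<in> \<K> \<Longrightarrow> K \<inter> C \<noteq> {}"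
  obtains A where "closedin X A" "A \<subseteq> C" "irreducible_in X A"
    "\<And>K. K \<in> \<K> \<Longrightarrow> K \<inter> A \<noteq> {}"
    "\<And>B. closedin X B \<Longrightarrow> B \<subseteq> A \<Longrightarrow> (\<And>K. K \<in> \<K> \<Longrightarrow> K \<inter> B \<noteq> {}) \<Longrightarrow> B = A"
proof -
  have \<K>: "\<K> \<subseteq> compact_saturated X" "\<K> \<noteq> {}"
    using irr by (auto simp: irreducible_in_def)
  have KX: "K \<subseteq> topspace X" if "K \<in> \<K>" for K
    using \<K> that compact_saturated_subset_topspace by blast
  define \<O> where "\<O> = {U. openin X U \<and> topspace X - C \<subseteq> U \<and> (\<forall>K\<in>\<K>. \<not> K \<subseteq> U)}"
  have "topspace X - C \<in> \<O>"
    using C meet by (auto simp: \<O>_def)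
  moreover have "\<Union>\<C> \<in> \<O>" if \<C>: "\<C> \<noteq> {}" "subset.chain \<O> \<C>" for \<C>
  proof -
    have sub: "\<C> \<subseteq> \<O>"
      using \<C>(2) by (simp add: subset.chain_def)
    have "\<not> K \<subseteq> \<Union>\<C>" if K: "K \<in> \<K>" for K
    proof
      assume "K \<subseteq> \<Union>\<C>"
      moreover have "compactin X K"
        using K \<K> by (auto simp: compact_saturated_def)
      moreover have "\<forall>U\<in>\<C>. openin X U"
        using sub by (auto simp: \<O>_def)
      ultimately obtain \<F> where \<F>: "finite \<F>" "\<F> \<subseteq> \<C>" "K \<subseteq> \<Union>\<F>"
        unfolding compactin_def by metis
      have "\<F> \<noteq> {}"
        using \<F>(3) meet[OF K] by auto
      moreover have "subset.chain \<O> \<F>"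
        using \<C>(2) \<F>(2) by (meson subsetD subset_chain_def subset_trans)
      ultimately have "\<Union>\<F> \<in> \<F>"
        using \<F>(1) Union_in_chain by blast
      then show False
        using \<F> sub K by (auto simp: \<O>_def)
    qed
    moreover have "openin X (\<Union>\<C>)"
      using sub by (auto simp: \<O>_def)
    moreover have "topspace X - C \<subseteq> \<Union>\<C>"
    proof -
      obtain U where "U \<in> \<C>"
        using \<C>(1) by blast
      moreover from this have "topspace X - C \<subseteq> U"
        using sub by (auto simp: \<O>_def)
      ultimately show ?thesis by blast
    qed
    ultimately show ?thesis
      by (simp add: \<O>_def)
  qed
  ultimately obtain M where M: "M \<in> \<O>" and max: "\<And>U. U \<in> \<O> \<Longrightarrow> M \<subseteq> U \<Longrightarrow> U = M"
    using subset_Zorn_nonempty[of \<O>] by blast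
  define A where "A = topspace X - M"
  have MX: "openin X M" "M \<subseteq> topspace X"
    using M openin_subset by (auto simp: \<O>_def)
  have clA: "closedin X A" and AC: "A \<subseteq> C"
    using M MX by (auto simp: A_def \<O>_def)
  have meetA: "K \<inter> A \<noteq> {}" if "K \<in> \<K>" for K
  proof -
    have "\<not> K \<subseteq> M"
      using M that by (simp add: \<O>_def)
    then show ?thesis
      using KX[OF that] by (auto simp: A_def)
  qed
  have minA: "B = A"
    if B: "closedin X B" "B \<subseteq> A" "\<And>K. K \<in> \<K> \<Longrightarrow> K \<inter> B \<noteq> {}" for B
  proof -
    have "openin X (topspace X - B)"
      using B(1) by blast
    moreover have "topspace X - C \<subseteq> topspace X - B"
      using B(2) AC by blast
    moreover have "\<not> K \<subseteq> topspace X - B" if "K \<in> \<K>" for K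
      using B(3)[OF that] by blast
    ultimately have "topspace X - B \<in> \<O>"
      by (simp add: \<O>_def)
    moreover have "M \<subseteq> topspace X - B"
      using B(2) MX by (auto simp: A_def)
    ultimately have "topspace X - B = M"
      by (rule max)
    then show "B = A"
      using closedin_subset[OF B(1)] by (auto simp: A_def)
  qed
  have "irreducible_in X A"
    unfolding irreducible_in_def
  proof (intro conjI allI impI)
    show "A \<subseteq> topspace X"
      by (auto simp: A_def)
    show "A \<noteq> {}"
      using \<K>(2) meetA by blast
    fix F1 F2 assume F: "closedin X F1 \<and> closedin X F2 \<and> A \<subseteq> F1 \<union> F2"
    show "A \<subseteq> F1 \<or> A \<subseteq> F2"
    proof (rule ccontr)
      assume neg: "\<not> (A \<subseteq> F1 \<or> A \<subseteq> F2)"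
      define miss where "miss = (\<lambda>F. smyth_box X (topspace X - (A \<inter> F)))"
      have miss_iff: "K \<in> miss F \<longleftrightarrow> K \<inter> (A \<inter> F) = {}" if "K \<in> \<K>" for K F
        using that \<K>(1) KX[OF that] by (auto simp: miss_def smyth_box_def)
      have closed: "closedin (smyth_power X) (compact_saturated X - miss F)" if "closedin X F" for F
      proof -
        have "openin (smyth_power X) (miss F)"
          unfolding miss_def using clA that by (intro openin_smyth_box) blast
        then show ?thesis
          using closedin_diff[OF closedin_topspace, of "smyth_power X"] by simp
      qed
      have "\<exists>K\<in>\<K>. K \<in> miss F" if "closedin X F" "\<not> A \<subseteq> F" for F
        using minA[of "A \<inter> F"] clA that miss_iff by blast
      then have "\<not> \<K> \<subseteq> compact_saturated X - miss F1" "\<not> \<K> \<subseteq> compact_saturated X - miss F2"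
        using F neg by blast+
      moreover have "closedin (smyth_power X) (compact_saturated X - miss F1)"
        "closedin (smyth_power X) (compact_saturated X - miss F2)"
        using closed F by auto
      ultimately have "\<not> \<K> \<subseteq> (compact_saturated X - miss F1) \<union> (compact_saturated X - miss F2)"
        using irr unfolding irreducible_in_def by metis
      then obtain K where K: "K \<in> \<K>" "K \<in> miss F1" "K \<in> miss F2"
        using \<K>(1) by blast
      then have "K \<inter> (A \<inter> F1) = {}" "K \<inter> (A \<inter> F2) = {}"
        using miss_iff by simp_all
      then have "K \<inter> A = {}"
        using F by blast
      then show False
        using meetA K(1) by blast
    qed
  qed
  then show ?thesis
    using that clA AC meetA minA by blast
qed

text \<open>
  The hypothesis says that \<open>\<K>\<close> behaves like a filtered family in a well-filtered space. Taking
  \<open>U = {}\<close> shows that the intersection is nonempty, and taking for \<open>U\<close> the union of an open cover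
  shows that it is compact.
\<close>

lemma smyth_generic_point:
  assumes \<K>: "\<K> \<subseteq> compact_saturated X" "\<K> \<noteq> {}"
    and wf: "\<And>U. openin X U \<Longrightarrow> \<Inter>\<K> \<subseteq> U \<Longrightarrow> \<exists>K\<in>\<K>. K \<subseteq> U"
  shows "\<Inter>\<K> \<in> compact_saturated X"
    and "smyth_power X closure_of \<K> = smyth_power X closure_of {\<Inter>\<K>}"
proof -
  have sat: "compactin X K" "saturated_in X K" "K \<noteq> {}" if "K \<in> \<K>" for K
    using that \<K> by (auto simp: compact_saturated_def)
  have sub: "\<Inter>\<K> \<subseteq> topspace X"
    using \<K> compact_saturated_subset_topspace by blast
  have "\<Inter>\<K> \<noteq> {}"
    using wf[of "{}"] sat(3) by force
  moreover have "saturated_in X (\<Inter>\<K>)"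
  proof (rule upper_imp_saturated_in[OF sub])
    fix x y assume xy: "x \<in> \<Inter>\<K>" "spec_le X x y"
    have "y \<in> K" if "K \<in> \<K>" for K
      using saturated_in_upper[OF sat(2)[OF that] _ xy(2)] xy(1) that by blast
    then show "y \<in> \<Inter>\<K>" by blast
  qed
  moreover have "compactin X (\<Inter>\<K>)"
    unfolding compactin_def
  proof (intro conjI allI impI sub)
    fix \<U> assume \<U>: "(\<forall>U\<in>\<U>. openin X U) \<and> \<Inter>\<K> \<subseteq> \<Union>\<U>"
    then obtain K where K: "K \<in> \<K>" "K \<subseteq> \<Union>\<U>"
      using wf[of "\<Union>\<U>"] by blast
    then obtain \<F> where "finite \<F>" "\<F> \<subseteq> \<U>" "K \<subseteq> \<Union>\<F>"
      using sat(1) \<U> unfolding compactin_def by metis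
    then show "\<exists>\<F>. finite \<F> \<and> \<F> \<subseteq> \<U> \<and> \<Inter>\<K> \<subseteq> \<Union>\<F>"
      using K(1) by blast
  qed
  ultimately show Q: "\<Inter>\<K> \<in> compact_saturated X"
    by (simp add: compact_saturated_def)
  have "\<K> \<subseteq> smyth_power X closure_of {\<Inter>\<K>}"
    using smyth_closure_of_singleton[OF Q] \<K>(1) by blast
  moreover have "\<Inter>\<K> \<in> smyth_power X closure_of \<K>"
    using Q wf by (simp add: in_smyth_closure_of[OF \<K>(1)])
  ultimately show "smyth_power X closure_of \<K> = smyth_power X closure_of {\<Inter>\<K>}"
    by (intro equalityI closure_of_minimal) auto
qed


section \<open>Irreducible sets in products\<close>

lemma irreducible_in_meets_finite_Inter:
  assumes A: "irreducible_in X A" and "finite \<F>"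
    and "\<And>U. U \<in> \<F> \<Longrightarrow> openin X U" "\<And>U. U \<in> \<F> \<Longrightarrow> A \<inter> U \<noteq> {}"
  shows "A \<inter> \<Inter>\<F> \<noteq> {}"
proof -
  have AX: "A \<subseteq> topspace X"
    using A by (simp add: irreducible_in_def)
  have "openin X (topspace X \<inter> \<Inter>\<F>) \<and> A \<inter> \<Inter>\<F> \<noteq> {}"
    using assms(2-)
  proof (induction \<F> rule: finite_induct)
    case empty
    then show ?case
      using A by (simp add: irreducible_in_def)
  next
    case (insert U \<F>)
    then have U: "openin X U" "A \<inter> U \<noteq> {}"
      and V: "openin X (topspace X \<inter> \<Inter>\<F>)" "A \<inter> \<Inter>\<F> \<noteq> {}" by auto
    have "openin X (U \<inter> (topspace X \<inter> \<Inter>\<F>))"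
      using U(1) V(1) by (rule openin_Int)
    moreover have "A \<inter> \<Inter>(insert U \<F>) \<noteq> {}"
    proof
      assume "A \<inter> \<Inter>(insert U \<F>) = {}"
      then have "A \<subseteq> (topspace X - U) \<union> (topspace X - (topspace X \<inter> \<Inter>\<F>))"
        using AX by auto
      moreover have "closedin X (topspace X - U)" "closedin X (topspace X - (topspace X \<inter> \<Inter>\<F>))"
        using U(1) V(1) by blast+
      ultimately have "A \<subseteq> topspace X - U \<or> A \<subseteq> topspace X - (topspace X \<inter> \<Inter>\<F>)"
        using A unfolding irreducible_in_def by blast
      then show False
        using U(2) V(2) AX by blast
    qed
    ultimately show ?case
      by (simp add: Int_left_commute)
  qed
  then show ?thesis by blast
qed

text \<open>
  A basic open set of the product is a finite intersection of open cylinders, and an irreducible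
  set that meets each cylinder meets their intersection.
\<close>

lemma irreducible_in_product_closure:
  assumes A: "irreducible_in (product_topology X I) A"
    and x: "x \<in> extensional I" "\<And>i. i \<in> I \<Longrightarrow> x i \<in> X i closure_of ((\<lambda>y. y i) ` A)"
  shows "x \<in> product_topology X I closure_of A"
proof -
  let ?P = "product_topology X I"
  have AP: "A \<subseteq> topspace ?P"
    using A by (simp add: irreducible_in_def)
  have xi: "x i \<in> topspace (X i)" if "i \<in> I" for i
    using x(2)[OF that] by (simp add: in_closure_of)
  have "\<exists>y. y \<in> A \<and> y \<in> T" if T: "x \<in> T" "openin ?P T" for T
  proof -
    obtain U where U: "finite {i \<in> I. U i \<noteq> topspace (X i)}" "\<And>i. i \<in> I \<Longrightarrow> openin (X i) (U i)"
        "x \<in> Pi\<^sub>E I U" "Pi\<^sub>E I U \<subseteq> T"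
      using bspec[OF T(2)[unfolded openin_product_topology_alt] T(1)] by (elim exE conjE) blast
    define cyl where "cyl = (\<lambda>i. {y \<in> topspace ?P. y i \<in> U i})"
    let ?\<F> = "cyl ` {i \<in> I. U i \<noteq> topspace (X i)}"
    have "openin ?P (cyl i)" if "i \<in> I" for i
      unfolding cyl_def
      using continuous_map_product_projection[OF that] U(2)[OF that]
      by (rule openin_continuous_map_preimage)
    moreover have "A \<inter> cyl i \<noteq> {}" if i: "i \<in> I" for i
    proof -
      have "x i \<in> U i"
        using U(3) i by auto
      then have "\<exists>a. a \<in> (\<lambda>y. y i) ` A \<and> a \<in> U i"
        using x(2)[OF i] U(2)[OF i] unfolding in_closure_of by blast
      then show ?thesis
        using AP unfolding cyl_def by blast
    qed
    ultimately have "A \<inter> \<Inter>?\<F> \<noteq> {}"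
      using U(1) by (intro irreducible_in_meets_finite_Inter[OF A]) auto
    then obtain y where y: "y \<in> A" "y \<in> \<Inter>?\<F>" by blast
    have "y \<in> topspace ?P"
      using AP y(1) by blast
    moreover have "y i \<in> U i" if i: "i \<in> I" for i
    proof (cases "U i = topspace (X i)")
      case True
      then show ?thesis
        using calculation i by (auto simp: PiE_iff)
    next
      case False
      then show ?thesis
        using y(2) i by (auto simp: cyl_def)
    qed
    ultimately have "y \<in> Pi\<^sub>E I U"
      by (auto simp: PiE_iff)
    then show ?thesis
      using y(1) U(4) by blast
  qed
  then show ?thesis
    using x(1) xi by (auto simp: in_closure_of PiE_iff)
qed

text \<open>
  The generic point \<open>Q\<close> of the projected family lies inside each of its members. It must meet the
  closed set \<open>C\<close>: otherwise the complement of \<open>C\<close> is a neighbourhood of \<open>Q\<close>, so it includes a member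
  of the family, which is impossible since each member contains points of \<open>f ` A\<close>.
\<close>

lemma generic_coordinate:
  fixes H :: "'u topology \<Rightarrow> 'u set set" and e :: "'b set \<Rightarrow> 'u"
  assumes H: "R_subset_system H" and Y: "H_sober H (smyth_power Y)"
    and e: "inj_on e (topspace (smyth_power Y))" and f: "continuous_map X Y f"
    and \<K>: "(\<lambda>K. up_closure X (K \<inter> A)) ` \<K> \<in> H_at H (smyth_power X)"
    and A: "A \<subseteq> topspace X" and meet: "\<And>K. K \<in> \<K> \<Longrightarrow> K \<inter> A \<noteq> {}"
  obtains x where "x \<in> Y closure_of (f ` A)" "\<And>K. K \<in> \<K> \<Longrightarrow> \<exists>y\<in>K \<inter> A. spec_le Y (f y) x"
proof -
  let ?\<L> = "(\<lambda>K. up_closure Y (f ` (K \<inter> A))) ` \<K>"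
  have "smyth_map Y f (up_closure X (K \<inter> A)) = up_closure Y (f ` (K \<inter> A))" for K
    using A by (intro smyth_map_up_closure[OF f]) auto
  then have \<L>: "?\<L> \<in> H_at H (smyth_power Y)"
    using H_at_image[OF H t0_space_smyth_power t0_space_smyth_power e continuous_map_smyth_map[OF f] \<K>]
    by (simp add: image_image)
  then have \<L>Y: "?\<L> \<subseteq> compact_saturated Y"
    by (simp add: H_at_def)
  obtain Q where Q: "Q \<in> compact_saturated Y"
    "smyth_power Y closure_of ?\<L> = smyth_power Y closure_of {Q}"
    using Y \<L> unfolding H_sober_def by force
  let ?C = "Y closure_of (f ` A)"
  have fA: "f ` A \<subseteq> topspace Y"
    using f A by (auto simp: continuous_map_def)
  have "Q \<inter> ?C \<noteq> {}"
  proof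
    assume disj: "Q \<inter> ?C = {}"
    have "Q \<in> smyth_power Y closure_of ?\<L>"
      using Q(1) smyth_closure_of_singleton[OF Q(1)] Q(2) by simp
    moreover have "openin Y (topspace Y - ?C)" "Q \<subseteq> topspace Y - ?C"
      using disj compact_saturated_subset_topspace[OF Q(1)] by auto
    ultimately obtain K where K: "K \<in> \<K>" "up_closure Y (f ` (K \<inter> A)) \<subseteq> topspace Y - ?C"
      using in_smyth_closure_of[OF \<L>Y] by (metis (no_types, lifting) image_iff)
    moreover have "f ` (K \<inter> A) \<subseteq> up_closure Y (f ` (K \<inter> A))"
      using fA by (intro subset_up_closure) auto
    moreover have "f ` A \<subseteq> ?C"
      using fA by (rule closure_of_subset)
    ultimately show False
      using meet[OF K(1)] by blast
  qed
  then obtain x where x: "x \<in> Q" "x \<in> ?C" by blast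
  have "?\<L> \<subseteq> smyth_power Y closure_of ?\<L>"
    using \<L>Y by (intro closure_of_subset) simp
  then have "Q \<subseteq> L" if "L \<in> ?\<L>" for L
    using that Q(2) smyth_closure_of_singleton[OF Q(1)] by blast
  then have "x \<in> up_closure Y (f ` (K \<inter> A))" if "K \<in> \<K>" for K
    using x(1) that by blast
  then have "\<exists>y\<in>K \<inter> A. spec_le Y (f y) x" if "K \<in> \<K>" for K
    using that unfolding up_closure_def by fast
  then show ?thesis
    using that x(2) by blast
qed


section \<open>Products of super \<open>H\<close>-sober spaces\<close>

text \<open>
  The sections of the projections serve twice: they make the factors retracts of the product, and
  they embed the compact saturated sets of a factor into those of the product and so into the
  universe \<open>'u\<close>.
\<close>

theorem theorem6p18:
  fixes H :: "'u topology \<Rightarrow> 'u set set"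
    and X :: "'i \<Rightarrow> 'a topology" and I :: "'i set"
    and e :: "('i \<Rightarrow> 'a) set \<Rightarrow> 'u"
  assumes "R_subset_system H" and "property_M H"
    and "\<And>i. i \<in> I \<Longrightarrow> t0_space (X i)"
    and "\<And>i. i \<in> I \<Longrightarrow> topspace (X i) \<noteq> {}"
    and universe: "inj_on e (topspace (smyth_power (product_topology X I)))"
  shows "super_H_sober H (product_topology X I) \<longleftrightarrow> (\<forall>i\<in>I. super_H_sober H (X i))"
proof -
  let ?P = "product_topology X I"
  have P0: "t0_space ?P"
    using assms(3) by (simp add: t0_space_product_topology)
  have "topspace ?P \<noteq> {}"
    using assms(4) by (simp add: PiE_eq_empty_iff)
  then have "?P \<noteq> trivial_topology"
    unfolding null_topspace_iff_trivial .
  then have "\<exists>s. retraction_maps ?P (X i) (\<lambda>x. x i) s" if "i \<in> I" for i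
    using that retraction_map_product_projection[of i I X]
    by (simp add: retraction_map_def)
  then obtain s where s: "\<And>i. i \<in> I \<Longrightarrow> retraction_maps ?P (X i) (\<lambda>x. x i) (s i)"
    by metis
  show ?thesis
  proof
    assume "super_H_sober H ?P"
    then have "H_sober H (smyth_power ?P)"
      by (simp add: super_H_sober_def)
    then have "H_sober H (smyth_power (X i))" if "i \<in> I" for i
      using H_sober_retract[OF assms(1) _ t0_space_smyth_power universe]
        retraction_maps_smyth_map[OF s[OF that]] by blast
    then show "\<forall>i\<in>I. super_H_sober H (X i)"
      using assms(3) by (simp add: super_H_sober_def)
  next
    assume factors: "\<forall>i\<in>I. super_H_sober H (X i)"
    have wf: "\<exists>K\<in>\<K>. K \<subseteq> U"
      if \<K>: "\<K> \<in> H_at H (smyth_power ?P)" and U: "openin ?P U" "\<Inter>\<K> \<subseteq> U" for \<K> U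
    proof (rule ccontr)
      assume neg: "\<not> (\<exists>K\<in>\<K>. K \<subseteq> U)"
      have \<K>P: "K \<subseteq> topspace ?P" "saturated_in ?P K" if "K \<in> \<K>" for K
        using \<K> that compact_saturated_subset_topspace[of K ?P]
        by (auto simp: H_at_def compact_saturated_def)
      have irr: "irreducible_in (smyth_power ?P) \<K>"
        using assms(1) t0_space_smyth_power \<K> by (rule H_at_irreducible)
      have "closedin ?P (topspace ?P - U)"
        using U(1) by blast
      moreover have "K \<inter> (topspace ?P - U) \<noteq> {}" if "K \<in> \<K>" for K
        using neg that \<K>P(1)[OF that] by blast
      ultimately obtain A where A: "closedin ?P A" "A \<subseteq> topspace ?P - U" "irreducible_in ?P A"
        and meet: "\<And>K. K \<in> \<K> \<Longrightarrow> K \<inter> A \<noteq> {}"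
        and min: "\<And>B. closedin ?P B \<Longrightarrow> B \<subseteq> A \<Longrightarrow> (\<And>K. K \<in> \<K> \<Longrightarrow> K \<inter> B \<noteq> {}) \<Longrightarrow> B = A"
        using topological_Rudin[OF irr] by blast
      have AP: "A \<subseteq> topspace ?P"
        using A(2) by blast
      have \<K>A: "(\<lambda>K. up_closure ?P (K \<inter> A)) ` \<K> \<in> H_at H (smyth_power ?P)"
        using assms(1,2) P0 universe \<K> A(1) meet by (rule property_M_at)
      have "\<exists>a. a \<in> X i closure_of ((\<lambda>y. y i) ` A) \<and> (\<forall>y\<in>A. spec_le (X i) (y i) a)"
        if i: "i \<in> I" for i
      proof -
        have pi: "continuous_map ?P (X i) (\<lambda>y. y i)"
          using i by (rule continuous_map_product_projection)
        have "H_sober H (smyth_power (X i))"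
          using factors i by (simp add: super_H_sober_def)
        then obtain a where a: "a \<in> X i closure_of ((\<lambda>y. y i) ` A)"
          and below: "\<And>K. K \<in> \<K> \<Longrightarrow> \<exists>y\<in>K \<inter> A. spec_le (X i) (y i) a"
          using generic_coordinate[OF assms(1) _ inj_on_smyth_power_retract[OF s[OF i] universe]
              pi \<K>A AP meet] by metis
        \<comment> \<open>The witnesses \<open>y \<in> K \<inter> A\<close> below \<open>a\<close> show that this part of \<open>A\<close> still meets every \<open>K\<close>.\<close>
        define B where "B = {y \<in> topspace ?P. y i \<in> X i closure_of {a}} \<inter> A"
        have "closedin ?P B"
          unfolding B_def
          using closedin_continuous_map_preimage[OF pi closedin_closure_of] A(1)
          by (rule closedin_Int)
        moreover have "B \<subseteq> A"
          by (simp add: B_def)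
        moreover have "K \<inter> B \<noteq> {}" if "K \<in> \<K>" for K
          using below[OF that] AP unfolding B_def spec_le_def by blast
        ultimately have "B = A"
          by (rule min)
        moreover have "a \<in> topspace (X i)"
          using a by (simp add: in_closure_of)
        ultimately have "spec_le (X i) (y i) a" if "y \<in> A" for y
          using that AP i unfolding B_def spec_le_def by (auto simp: PiE_iff)
        then show ?thesis
          using a by blast
      qed
      then obtain a where a: "\<And>i. i \<in> I \<Longrightarrow> a i \<in> X i closure_of ((\<lambda>y. y i) ` A)"
        "\<And>i y. i \<in> I \<Longrightarrow> y \<in> A \<Longrightarrow> spec_le (X i) (y i) (a i)"
        by metis
      define x where "x = restrict a I"
      have "x \<in> ?P closure_of A"
        using a(1) by (intro irreducible_in_product_closure[OF A(3)]) (auto simp: x_def)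
      then have xA: "x \<in> A"
        using A(1) by (simp add: closure_of_closedin)
      have "x \<in> K" if K: "K \<in> \<K>" for K
      proof -
        obtain y where y: "y \<in> K" "y \<in> A"
          using meet[OF K] by blast
        have "x \<in> topspace ?P" "y \<in> topspace ?P"
          using xA y(2) AP by blast+
        moreover have "spec_le (X i) (y i) (x i)" if "i \<in> I" for i
          using a(2)[OF that y(2)] that by (simp add: x_def)
        ultimately have "spec_le ?P y x"
          by (rule spec_le_product_topology)
        then show ?thesis
          using saturated_in_upper[OF \<K>P(2)[OF K] y(1)] by blast
      qed
      then have "x \<in> U"
        using U(2) by blast
      then show False
        using xA A(2) by blast
    qed
    have "H_sober H (smyth_power ?P)"
      unfolding H_sober_def
    proof (intro conjI ballI t0_space_smyth_power)
      fix \<K> assume \<K>: "\<K> \<in> H_at H (smyth_power ?P)"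
      have "\<K> \<subseteq> compact_saturated ?P" "\<K> \<noteq> {}"
        using H_at_irreducible[OF assms(1) t0_space_smyth_power \<K>]
        by (auto simp: irreducible_in_def)
      from smyth_generic_point[OF this wf[OF \<K>]]
      show "\<exists>Q\<in>topspace (smyth_power ?P).
          smyth_power ?P closure_of \<K> = smyth_power ?P closure_of {Q}"
        by auto
    qed
    then show "super_H_sober H ?P"
      using P0 by (simp add: super_H_sober_def)
  qed
qed

end
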